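(* Let $s>0$, let $y\in\operatorname{supp}\mu$ with $\mu(\{y\})=0$, and assume that for every nonincreasing sequence of radii $(\rho_n)_{n\in\mathbb{N}}$ with $\sum_n\mu(B(y,\rho_n))^{s}=\infty$, the sequence of balls $\{B(y,\rho_n)\}$ is a BC sequence for $T$. Then $$\underline{R}(x,y)\le s\qquad\text{for } \mu\text{-a.e. } x\in X.$$ In particular, if $\mu$ is non-atomic and $(X,T,\mu)$ has $s$MSTP with $s\ge 1$, then for every $y\in\operatorname{supp}\mu$, $$1\le \underline{R}(x,y)\le s\qquad\text{for } \mu\text{-a.e. } x\in X.$$
   Context: Standing assumptions: $(X,d)$ is a metric space, $\mu$ is a Borel probability measure on $X$, and $T:X\to X$ is measurable and preserves $\mu$, i.e. $\mu(T^{-1}A)=\mu(A)$ for all Borel $A$. $\mathbb{N}=\{1,2,\dots\}$. $B(y,r)=\{x\in X: d(x,y)\le r\}$ is the closed ball of center $y$ and radius $r>0$. The support $\operatorname{supp}\mu$ is the set of $y$ with $\mu(B(y,r))>0$ for all $r>0$. BC sequence: a sequence $\{A_n\}_{n\in\mathbb{N}}$ of measurable subsets of $X$ is a Borel-Cantelli (BC) sequence for $T$ if $\mu(\limsup_n T^{-n}A_n)=1$, where $\limsup_n T^{-n}A_n=\{x: T^nx\in A_n\text{ for infinitely many }n\}$. $s$MSTP (for $s\ge1$): $(X,T,\mu)$ has the $s$-exponent monotone shrinking target property if for every $y\in X$ and every nonincreasing sequence of radii $(r_n)_{n\in\mathbb{N}}$ with $\sum_n\mu(B(y,r_n))^s=\infty$,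 the sequence $\{B(y,r_n)\}$ is BC for $T$. Waiting time: for measurable $A\subset X$, $\tau_A(x)=\min\{n\in\mathbb{N}:T^nx\in A\}\in\mathbb{N}\cup\{\infty\}$ (with $\log\infty=\infty$). For $y\in\operatorname{supp}\mu$ with $\mu(\{y\})=0$, $$\underline{R}(x,y)=\liminf_{r\to0}\frac{\log\tau_{B(y,r)}(x)}{-\log\mu(B(y,r))}.$$ Non-atomic means $\mu(\{z\})=0$ for all $z\in X$. *)

theory Defs
  imports "HOL-Probability.Probability"
begin

text \<open>
  The metric space $X$ is a type of class \<open>metric_space\<close>, and sequences indexed by
  $\{1,2,\dots\}$ are functions on \<^typ>\<open>nat\<close> of which only the values at positive indices matter.
\<close>

definition measure_preserving_map :: "'a measure \<Rightarrow> ('a \<Rightarrow> 'a) \<Rightarrow> bool" where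
  "measure_preserving_map M T \<longleftrightarrow>
     T \<in> M \<rightarrow>\<^sub>M M \<and> (\<forall>A\<in>sets M. measure M (T -` A \<inter> space M) = measure M A)"

definition nonatomic :: "'a measure \<Rightarrow> bool" where
  "nonatomic M \<longleftrightarrow> (\<forall>z\<in>space M. measure M {z} = 0)"

definition supp :: "'a::metric_space measure \<Rightarrow> 'a set" where
  "supp M = {y. \<forall>r>0. measure M (cball y r) > 0}"

definition BC_sequence :: "'a measure \<Rightarrow> ('a \<Rightarrow> 'a) \<Rightarrow> (nat \<Rightarrow> 'a set) \<Rightarrow> bool" where
  "BC_sequence M T A \<longleftrightarrow>
     (\<forall>n\<ge>1. A n \<in> sets M) \<and>
     measure M {x \<in> space M. infinite {n. n \<ge> 1 \<and> (T ^^ n) x \<in> A n}} = 1"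

text \<open>The shrinking target property with exponent \<open>s\<close> for balls centred at one given point \<open>y\<close>.
  The series is over $n \ge 1$, hence the shift by \<^const>\<open>Suc\<close>.\<close>

definition MSTP_at :: "'a::metric_space measure \<Rightarrow> ('a \<Rightarrow> 'a) \<Rightarrow> real \<Rightarrow> 'a \<Rightarrow> bool" where
  "MSTP_at M T s y \<longleftrightarrow>
     (\<forall>\<rho> :: nat \<Rightarrow> real.
        (\<forall>n\<ge>1. \<rho> n > 0) \<longrightarrow> antimono_on {1..} \<rho> \<longrightarrow>
        (\<Sum>n. ennreal (measure M (cball y (\<rho> (Suc n))) powr s)) = \<infinity> \<longrightarrow>
        BC_sequence M T (\<lambda>n. cball y (\<rho> n)))"

definition MSTP :: "'a::metric_space measure \<Rightarrow> ('a \<Rightarrow> 'a) \<Rightarrow> real \<Rightarrow> bool" where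
  "MSTP M T s \<longleftrightarrow> (\<forall>y. MSTP_at M T s y)"

text \<open>The infimum of the empty set in \<^typ>\<open>enat\<close> is \<open>\<infinity>\<close>; that of a nonempty set is its minimum.\<close>

definition waiting_time :: "('a \<Rightarrow> 'a) \<Rightarrow> 'a set \<Rightarrow> 'a \<Rightarrow> enat" where
  "waiting_time T A x = Inf {enat n |n. n \<ge> 1 \<and> (T ^^ n) x \<in> A}"

definition log_enat :: "enat \<Rightarrow> ereal" where
  "log_enat t = (case t of enat n \<Rightarrow> ereal (ln (real n)) | \<infinity> \<Rightarrow> \<infinity>)"

text \<open>Meaningful for \<open>y \<in> supp M\<close> with \<open>measure M {y} = 0\<close>: then, for all small \<open>r > 0\<close>,
  the denominator is a positive finite number.\<close>

definition lower_R :: "'a::metric_space measure \<Rightarrow> ('a \<Rightarrow> 'a) \<Rightarrow> 'a \<Rightarrow> 'a \<Rightarrow> ereal" where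
  "lower_R M T x y =
     Liminf (at_right 0)
       (\<lambda>r. log_enat (waiting_time T (cball y r) x) / ereal (- ln (measure M (cball y r))))"

end

theory Submission
  imports Defs
begin

text \<open>
  Write \<open>f r\<close> for the measure of the closed ball of radius \<open>r\<close> about \<open>y\<close>; it is positive
  for \<open>r > 0\<close> and tends to \<open>0\<close> as \<open>r\<close> tends to \<open>0\<close>.

  Upper bound: pick radii \<open>r k\<close> decreasing to \<open>0\<close> so fast that \<open>- ln (f (r k)) \<ge> (k + 1)^2\<close>, and use
  the radius \<open>r k\<close> up to the time \<open>N k = \<lceil>k f (r k) powr - s\<rceil>\<close>. The first \<open>N k\<close> terms of the series
  \<open>\<Sum> f powr s\<close> then add up to at least \<open>k\<close>, so almost every orbit hits these balls infinitely often.
  A hit of the ball of radius \<open>r k\<close> before time \<open>N k\<close> bounds the ratio at \<open>r k\<close> by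
  \<open>s + 1 / (k + 1)\<close>.

  Lower bound: \<open>F x = f (dist y x)\<close> satisfies \<open>\<mu> (F \<le> t) \<le> t\<close>, so by Borel-Cantelli almost every
  orbit has \<open>F (T\<^sup>n x) > n powr - (1 + \<epsilon>)\<close> for large \<open>n\<close>. If \<open>T\<^sup>n x\<close> lies in the ball of radius \<open>r\<close>
  then \<open>F (T\<^sup>n x) \<le> f r\<close>, hence \<open>n\<close> exceeds \<open>f r powr - (1 / (1 + \<epsilon>))\<close>.
\<close>

section \<open>Bounds for waiting times and lower limits\<close>

lemma log_enat_waiting_time_le:
  assumes "n \<ge> 1" "(T ^^ n) x \<in> A"
  shows "log_enat (waiting_time T A x) \<le> ereal (ln (real n))"
proof -
  let ?S = "{enat n |n. n \<ge> 1 \<and> (T ^^ n) x \<in> A}"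
  have "enat n \<in> ?S" using assms by blast
  then have "Inf ?S \<in> ?S" "Inf ?S \<le> enat n"
    by (rule wellorder_InfI, rule Inf_lower)
  then show ?thesis
    unfolding waiting_time_def log_enat_def by auto
qed

lemma le_log_enat_waiting_time:
  assumes "\<And>n. n \<ge> 1 \<Longrightarrow> (T ^^ n) x \<in> A \<Longrightarrow> a \<le> ln (real n)"
  shows "ereal a \<le> log_enat (waiting_time T A x)"
proof -
  let ?S = "{enat n |n. n \<ge> 1 \<and> (T ^^ n) x \<in> A}"
  show ?thesis
  proof (cases "?S = {}")
    \<comment> \<open>An orbit that never hits \<open>A\<close> has waiting time
      \<open>Inf {} = \<infinity>\<close>, whose logarithm exceeds every real.\<close>
    case True
    then show ?thesis
      unfolding waiting_time_def log_enat_def by (simp only:) (simp add: top_enat_def)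
  next
    case False
    then have "Inf ?S \<in> ?S" by (metis (lifting) ex_in_conv wellorder_InfI)
    with assms show ?thesis
      unfolding waiting_time_def log_enat_def by auto
  qed
qed

lemma Liminf_le_of_frequently:
  fixes g :: "'b \<Rightarrow> 'c::complete_linorder"
  assumes "\<exists>\<^sub>F x in F. g x \<le> C"
  shows "Liminf F g \<le> C"
proof (rule ccontr)
  assume "\<not> Liminf F g \<le> C"
  then have "\<forall>\<^sub>F x in F. C < g x" by (intro less_LiminfD) auto
  with assms show False by (auto simp: frequently_def not_le)
qed

section \<open>Iterates of a measure-preserving map\<close>

lemma measurable_funpow:
  assumes "T \<in> M \<rightarrow>\<^sub>M M"
  shows "T ^^ n \<in> M \<rightarrow>\<^sub>M M"
  by (induction n) (use assms in \<open>auto intro: measurable_comp\<close>)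

lemma measure_preserving_map_funpow:
  assumes "measure_preserving_map M T" "A \<in> sets M"
  shows "measure M ((T ^^ n) -` A \<inter> space M) = measure M A"
  using assms(2)
proof (induction n arbitrary: A)
  case 0
  then show ?case by (simp add: sets.Int_space_eq2)
next
  case (Suc n)
  have T: "T \<in> M \<rightarrow>\<^sub>M M" using assms(1) by (simp add: measure_preserving_map_def)
  have "(T ^^ Suc n) -` A \<inter> space M = (T ^^ n) -` (T -` A \<inter> space M) \<inter> space M"
    using measurable_space[OF measurable_funpow[OF T]] by auto
  also have "measure M \<dots> = measure M (T -` A \<inter> space M)"
    using T Suc.prems by (intro Suc.IH measurable_sets)
  finally show ?case
    using Suc.prems assms(1) by (simp add: measure_preserving_map_def del: funpow.simps)
qed

section \<open>Measures of shrinking balls\<close>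

locale metric_prob_space = prob_space M for M :: "'a::metric_space measure" +
  assumes sets_borel: "sets M = sets borel"
begin

lemma space_UNIV: "space M = UNIV"
  using sets_eq_imp_space_eq[OF sets_borel] by simp

lemma cball_sets [measurable]: "cball y r \<in> sets M"
  by (simp add: sets_borel)

lemma measure_cball_mono: "r \<le> r' \<Longrightarrow> measure M (cball y r) \<le> measure M (cball y r')"
  by (intro finite_measure_mono subset_cball) auto

text \<open>Continuity from above along the radii \<open>1 / Suc n\<close>, whose balls intersect in
  \<open>{y}\<close>; monotonicity in the radius covers all other small \<open>r\<close>.\<close>

lemma measure_cball_tendsto_0:
  assumes "measure M {y} = 0"
  shows "((\<lambda>r. measure M (cball y r)) \<longlongrightarrow> 0) (at_right 0)"
proof (rule tendstoI)
  fix e :: real assume "e > 0"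
  have "(\<lambda>n. measure M (cball y (1 / real (Suc n)))) \<longlonglongrightarrow>
      measure M (\<Inter>n. cball y (1 / real (Suc n)))"
    by (intro finite_Lim_measure_decseq decseq_SucI subset_cball) (auto simp: field_simps)
  also have "(\<Inter>n. cball y (1 / real (Suc n))) = {y}"
  proof -
    have "x = y" if "\<forall>n. dist y x \<le> 1 / real (Suc n)" for x
    proof (rule ccontr)
      assume "x \<noteq> y"
      then obtain n where "inverse (real (Suc n)) < dist y x"
        using reals_Archimedean[of "dist y x"] by auto
      with that show False by (metis inverse_eq_divide not_less)
    qed
    then show ?thesis by auto
  qed
  finally have "(\<lambda>n. measure M (cball y (1 / real (Suc n)))) \<longlonglongrightarrow> 0" using assms by simp
  from order_tendstoD(2)[OF this \<open>e > 0\<close>]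
  obtain n where n: "measure M (cball y (1 / real (Suc n))) < e"
    by (auto simp: eventually_sequentially)
  have "\<forall>\<^sub>F r in at_right 0. r \<in> {0<..<1 / real (Suc n)}"
    by (rule eventually_at_right_real) simp
  then show "\<forall>\<^sub>F r in at_right 0. dist (measure M (cball y r)) 0 < e"
    proof eventually_elim
    case (elim r)
    then show ?case
      using n measure_cball_mono[of r "1 / real (Suc n)" y] by simp
  qed
qed

lemma radii_with_small_balls:
  assumes y: "measure M {y} = 0" and e: "\<And>k::nat. e k > 0"
  obtains r :: "nat \<Rightarrow> real" where "decseq r" "\<And>k. r k > 0" "r \<longlonglongrightarrow> 0"
    "\<And>k. measure M (cball y (r k)) < e k"
proof -
  have "\<exists>d. d > 0 \<and> measure M (cball y d) < e k" for k
  proof -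
    have "\<forall>\<^sub>F d in at_right 0. d > (0::real) \<and> measure M (cball y d) < e k"
      using eventually_at_right_less order_tendstoD(2)[OF measure_cball_tendsto_0[OF y] e]
      by (rule eventually_conj)
    then show ?thesis using eventually_happens' trivial_limit_at_right_real by blast
  qed
  then obtain d where d: "\<And>k. d k > 0" "\<And>k. measure M (cball y (d k)) < e k" by metis
  \<comment> \<open>The running minimum makes \<open>r\<close> decreasing, and the cap
    \<open>1 / Suc i\<close> forces it to \<open>0\<close>.\<close>
  define r where "r k = Min ((\<lambda>i. min (d i) (1 / real (Suc i))) ` {..k})" for k
  have le: "r k \<le> min (d k) (1 / real (Suc k))" for k
    unfolding r_def by (intro Min_le) auto
  have pos: "r k > 0" for k
    unfolding r_def using d(1) by (subst Min_gr_iff) auto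
  show thesis
  proof
    show "decseq r"
      unfolding decseq_def r_def by (intro allI impI Min_antimono image_mono) auto
    show "r k > 0" for k by (rule pos)
    show "r \<longlonglongrightarrow> 0"
    proof (rule tendsto_sandwich[of "\<lambda>_. 0" _ _ "\<lambda>k. 1 / real (Suc k)"])
      show "(\<lambda>k. 1 / real (Suc k)) \<longlonglongrightarrow> 0" by (rule LIMSEQ_Suc) (rule lim_1_over_n)
      show "\<forall>\<^sub>F k in sequentially. r k \<le> 1 / real (Suc k)"
        using le by simp
      show "\<forall>\<^sub>F k in sequentially. 0 \<le> r k"
        using pos by (simp add: less_imp_le)
    qed simp
    show "measure M (cball y (r k)) < e k" for k
      using measure_cball_mono[of "r k" "d k" y] le[of k] d(2)[of k] by simp
  qed
qed

section \<open>Upper bound from the shrinking target property\<close>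

text \<open>Radii that stay at least \<open>r k\<close> throughout the times
  \<open>1, ..., N k\<close> make the partial sum up to \<open>N k\<close> at least
  \<open>k\<close>, so the series diverges and the target property applies. Each hit it provides is
  a hit of some \<open>r k\<close> by time \<open>N k\<close>.\<close>

lemma AE_frequently_hits_slow_radii:
  fixes r :: "nat \<Rightarrow> real" and N :: "nat \<Rightarrow> nat"
  assumes mstp: "MSTP_at M T s y" and s: "s > 0"
    and r: "decseq r" "\<And>k. r k > 0"
    and N: "\<And>k. real k \<le> real (N k) * measure M (cball y (r k)) powr s" "\<And>k. k \<le> N k"
  shows "AE x in M. \<exists>\<^sub>F k in sequentially. \<exists>n. 1 \<le> n \<and> n \<le> N k \<and> (T ^^ n) x \<in> cball y (r k)"
proof -
  \<comment> \<open>\<open>K m\<close> is the first index whose time bound exceeds \<open>m\<close>.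
    Since \<open>N\<close> may fail to be monotone, taking the least such index is what makes
    \<open>K\<close> monotone.\<close>
  define K where "K m = (LEAST k. m < N k)" for m
  have K: "m < N (K m)" for m
    unfolding K_def by (rule LeastI[of "\<lambda>k. m < N k" "Suc m"]) (use N(2)[of "Suc m"] in simp)
  have K_le: "K m \<le> k" if "m < N k" for m k
    unfolding K_def using that by (rule Least_le)
  \<comment> \<open>Times start at \<open>1\<close>, so \<open>n \<le> N k\<close> amounts to
    \<open>n - 1 < N k\<close>.\<close>
  define \<rho> where "\<rho> n = r (K (n - 1))" for n
  have "(\<Sum>n. ennreal (measure M (cball y (\<rho> (Suc n))) powr s)) = \<infinity>" (is "?S = _")
  proof -
    have "ennreal (real k) \<le> ?S" for k
    proof -
      have "real k \<le> (\<Sum>m<N k. measure M (cball y (r k)) powr s)" using N(1)[of k] by simp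
      \<comment> \<open>For \<open>m < N k\<close> minimality gives \<open>K m \<le> k\<close>, so
        the radius in use is at least \<open>r k\<close>.\<close>
      also have "\<dots> \<le> (\<Sum>m<N k. measure M (cball y (\<rho> (Suc m))) powr s)"
        using K_le r(1) s
        by (intro sum_mono powr_mono2 measure_cball_mono) (auto simp: \<rho>_def decseq_def)
      finally have "ennreal (real k) \<le> (\<Sum>m<N k. ennreal (measure M (cball y (\<rho> (Suc m))) powr s))"
        by (subst sum_ennreal) (auto intro: ennreal_leI)
      also have "\<dots> \<le> ?S" by (intro sum_le_suminf) auto
      finally show ?thesis .
    qed
    then have "\<not> ?S < \<infinity>"
      using ennreal_Ex_less_of_nat[of ?S]
      by (metis ennreal_of_nat_eq_real_of_nat infinity_ennreal_def not_less)
    then show ?thesis by (simp add: less_top[symmetric])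
  qed
  moreover have "antimono_on {1..} \<rho>"
  proof (rule monotone_onI)
    fix a b :: nat assume "a \<in> {1..}" "a \<le> b"
    then have "a - 1 < N (K (b - 1))" using K[of "b - 1"] by simp
    then show "\<rho> b \<le> \<rho> a" unfolding \<rho>_def using r(1) K_le by (simp add: decseq_def)
  qed
  ultimately have "BC_sequence M T (\<lambda>n. cball y (\<rho> n))"
    using mstp r(2) unfolding MSTP_at_def by (auto simp: \<rho>_def[abs_def])
  then have "prob {x \<in> space M. infinite {n. n \<ge> 1 \<and> (T ^^ n) x \<in> cball y (\<rho> n)}} = 1"
    by (simp add: BC_sequence_def)
  from AE_prob_1[OF this] show ?thesis
  proof eventually_elim
    case (elim x)
    then have inf: "infinite {n. n \<ge> 1 \<and> (T ^^ n) x \<in> cball y (\<rho> n)}" by simp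
    show ?case
      unfolding frequently_sequentially
    proof
      fix k0
      \<comment> \<open>Infinitely many hits cannot all occur by the time bounds of the indices
        below \<open>k0\<close>; a hit at a later time \<open>n\<close> has
        \<open>K (n - 1) \<ge> k0\<close>.\<close>
      have "finite (\<Union>k<k0. {..N k})" by simp
      then have "\<not> {n. n \<ge> 1 \<and> (T ^^ n) x \<in> cball y (\<rho> n)} \<subseteq> (\<Union>k<k0. {..N k})"
        using inf finite_subset by blast
      then obtain n where n: "n \<ge> 1" "(T ^^ n) x \<in> cball y (\<rho> n)" "n \<notin> (\<Union>k<k0. {..N k})"
        by blast
      moreover have "n \<le> N (K (n - 1))" using K[of "n - 1"] n(1) by linarith
      moreover have "K (n - 1) \<ge> k0"
      proof (rule ccontr)
        assume "\<not> K (n - 1) \<ge> k0"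
        with \<open>n \<le> N (K (n - 1))\<close> n(3) show False by auto
      qed
      ultimately show "\<exists>k\<ge>k0. \<exists>n. 1 \<le> n \<and> n \<le> N k \<and> (T ^^ n) x \<in> cball y (r k)"
        unfolding \<rho>_def by blast
    qed
  qed
qed

text \<open>A lower limit is bounded by the values along any one sequence of radii, so infinitely
  many early hits of the balls of radius \<open>r k\<close> suffice.\<close>

lemma lower_R_le:
  assumes s: "s > 0" and supp: "y \<in> supp M" and y: "measure M {y} = 0" and mstp: "MSTP_at M T s y"
  shows "AE x in M. lower_R M T x y \<le> ereal s"
proof -
  define f where "f r = measure M (cball y r)" for r
  obtain r where r: "decseq r" "\<And>k. r k > 0" "r \<longlonglongrightarrow> 0"
    and fr: "\<And>k. f (r k) < exp (- (real (Suc k))\<^sup>2)"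
    unfolding f_def by (rule radii_with_small_balls[OF y, of "\<lambda>k. exp (- (real (Suc k))\<^sup>2)"]) auto
  have f_pos: "f (r k) > 0" for k
    using supp r(2) by (simp add: supp_def f_def)
  have L: "- ln (f (r k)) \<ge> (real (Suc k))\<^sup>2" for k
    using ln_less_cancel_iff[THEN iffD2, OF f_pos _ fr, of k] by simp
  \<comment> \<open>This absorbs the rounding in \<open>N k\<close>: the extra \<open>1\<close>
    costs at most one more copy of \<open>f (r k) powr - s\<close>.\<close>
  have f1: "f (r k) powr - s \<ge> 1" for k
  proof -
    have "f (r k) \<le> 1" by (simp add: f_def)
    then show ?thesis
      using powr_mono2'[of "- s" "f (r k)" 1] s f_pos[of k] by simp
  qed
  define N where "N k = nat \<lceil>real k * f (r k) powr - s\<rceil>" for k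
  have N_ge: "real k * f (r k) powr - s \<le> real (N k)" for k
    unfolding N_def by linarith
  have N_le: "real (N k) \<le> real (Suc k) * f (r k) powr - s" for k
  proof -
    have "real (N k) \<le> real k * f (r k) powr - s + 1"
      unfolding N_def using f1[of k] by (simp add: of_nat_ceiling)
    with f1[of k] show ?thesis by (simp add: algebra_simps)
  qed
  have "k \<le> N k" for k
  proof -
    have "real k * 1 \<le> real k * f (r k) powr - s" using f1 by (intro mult_left_mono) auto
    with N_ge[of k] show ?thesis by linarith
  qed
  moreover have "real k \<le> real (N k) * measure M (cball y (r k)) powr s" for k
  proof -
    have "real k = real k * f (r k) powr - s * f (r k) powr s"
      using f_pos[of k] by (simp add: powr_add[symmetric] mult.assoc)
    also have "\<dots> \<le> real (N k) * f (r k) powr s"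
      using N_ge by (intro mult_right_mono) auto
    finally show ?thesis by (simp add: f_def)
  qed
  ultimately have "AE x in M. \<exists>\<^sub>F k in sequentially.
      \<exists>n. 1 \<le> n \<and> n \<le> N k \<and> (T ^^ n) x \<in> cball y (r k)"
    by (intro AE_frequently_hits_slow_radii[OF mstp s r(1,2)])
  then show ?thesis
  proof eventually_elim
    case (elim x)
    define g where "g d = log_enat (waiting_time T (cball y d) x) / ereal (- ln (f d))" for d
    have g_le: "g (r k) \<le> ereal (s + 1 / real (Suc k))"
      if n: "1 \<le> n" "n \<le> N k" "(T ^^ n) x \<in> cball y (r k)" for n k
    proof -
      define l where "l = - ln (f (r k))"
      have l: "l \<ge> (real (Suc k))\<^sup>2" using L by (simp add: l_def)
      have l0: "l > 0" using l by (rule less_le_trans[rotated]) simp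
      have "log_enat (waiting_time T (cball y (r k)) x) \<le> ereal (ln (real n))"
        using n by (intro log_enat_waiting_time_le)
      also have "ln (real n) \<le> ln (real (Suc k) * f (r k) powr - s)"
        using n N_le[of k] by (subst ln_le_cancel_iff) (auto intro!: mult_pos_pos simp: f_pos)
      also have "\<dots> = ln (real (Suc k)) + s * l"
        using f_pos[of k] by (subst ln_mult_pos) (auto simp: ln_powr l_def)
      finally have "g (r k) \<le> ereal (ln (real (Suc k)) + s * l) / ereal l"
        unfolding g_def l_def[symmetric] using l0 by (intro ereal_divide_right_mono) auto
      also have "\<dots> = ereal (s + ln (real (Suc k)) / l)"
        using l0 by (simp add: field_simps)
      \<comment> \<open>The quadratic lower bound on \<open>l\<close> is used here: it makes the
        error coming from the factor \<open>Suc k\<close> vanish as \<open>k\<close> grows.\<close>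
      also have "ln (real (Suc k)) / l \<le> real (Suc k) / (real (Suc k))\<^sup>2"
        using l l0 ln_le_minus_one[of "real (Suc k)"]
        by (intro frac_le) auto
      also have "\<dots> = 1 / real (Suc k)" by (simp add: power2_eq_square)
      finally show ?thesis by simp
    qed
    have "lower_R M T x y \<le> ereal (s + e)" if e: "e > 0" for e :: real
    proof -
      obtain k0 where k0: "1 / real (Suc k0) < e"
        using reals_Archimedean[OF e] by (auto simp: inverse_eq_divide)
      have "\<exists>\<^sub>F k in sequentially. g (r k) \<le> ereal (s + e)"
        unfolding frequently_sequentially
      proof
        fix k1
        obtain k where k: "k \<ge> max k0 k1" "\<exists>n. 1 \<le> n \<and> n \<le> N k \<and> (T ^^ n) x \<in> cball y (r k)"
          using elim unfolding frequently_sequentially by blast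
        have "1 / real (Suc k) \<le> 1 / real (Suc k0)" using k(1) by (simp add: field_simps)
        then have "ereal (s + 1 / real (Suc k)) \<le> ereal (s + e)" using k0 by simp
        with k g_le show "\<exists>k\<ge>k1. g (r k) \<le> ereal (s + e)"
          by (meson max.bounded_iff order_trans)
      qed
      \<comment> \<open>As \<open>r\<close> tends to \<open>0\<close> from the right, what holds for
        infinitely many \<open>r k\<close> holds for arbitrarily small radii.\<close>
      moreover have "filterlim r (at_right 0) sequentially"
        using r(2,3) by (simp add: filterlim_at less_imp_neq[symmetric])
      ultimately have "\<exists>\<^sub>F d in at_right 0. g d \<le> ereal (s + e)"
        unfolding frequently_def by (auto dest: filterlim_iff[THEN iffD1, rule_format])
      then show ?thesis
        unfolding lower_R_def g_def f_def by (rule Liminf_le_of_frequently)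
    qed
    then show ?case by (auto intro: ereal_le_epsilon2)
  qed
qed

section \<open>Lower bound from Borel-Cantelli\<close>

lemma borel_measurable_measure_cball_dist:
  "(\<lambda>x. measure M (cball y (dist y x))) \<in> borel_measurable M"
proof -
  have "(\<lambda>r. measure M (cball y r)) \<in> borel_measurable borel"
    by (intro borel_measurable_mono monoI measure_cball_mono)
  moreover have "(\<lambda>x. dist y x) \<in> borel_measurable M"
    unfolding measurable_cong_sets[OF sets_borel refl]
    by (intro borel_measurable_continuous_onI continuous_intros)
  ultimately show ?thesis by (rule measurable_compose[rotated])
qed

text \<open>The sublevel set is a ball about \<open>y\<close> whose radius \<open>R\<close> is the
  supremum of the radii with \<open>f r \<le> t\<close>. Spheres may carry mass, so \<open>f\<close>
  can jump at \<open>R\<close>: the ball is closed if \<open>f R \<le> t\<close> and open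
  otherwise.\<close>

lemma measure_cball_dist_le:
  assumes t: "t \<ge> 0"
  shows "measure M {x. measure M (cball y (dist y x)) \<le> t} \<le> t"
proof (cases "t \<ge> 1")
  case True
  then show ?thesis using prob_le_1 order_trans by blast
next
  case False
  define f where "f r = measure M (cball y r)" for r
  define R where "R = Sup {r. f r \<le> t}"
  have mono: "f r \<le> f r'" if "r \<le> r'" for r r'
    unfolding f_def using that by (rule measure_cball_mono)
  \<comment> \<open>A ball of negative radius is empty, so the supremum is over a nonempty set even
    for \<open>t = 0\<close>.\<close>
  have "f (- 1) \<le> t" using t by (simp add: f_def)
  then have ne: "{r. f r \<le> t} \<noteq> {}" by blast
  have "\<exists>n. f (real n) > t"
  proof -
    have "(\<lambda>n. f (real n)) \<longlonglongrightarrow> measure M (\<Union>n. cball y (real n))"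
      unfolding f_def
      by (intro finite_Lim_measure_incseq incseq_SucI subset_cball) auto
    also have "(\<Union>n. cball y (real n)) = space M"
      using real_arch_simple by (auto simp: space_UNIV)
    finally have "\<forall>\<^sub>F n in sequentially. t < f (real n)"
      using False by (intro order_tendstoD) (auto simp: prob_space)
    then show ?thesis by (auto simp: eventually_sequentially)
  qed
  then obtain n where "f (real n) > t" by blast
  then have bdd: "bdd_above {r. f r \<le> t}"
    using mono by (intro bdd_aboveI[of _ "real n"]) (metis mem_Collect_eq nle_le not_less order_trans)
  have below: "f r \<le> t" if "r < R" for r
  proof -
    obtain r' where "f r' \<le> t" "r < r'"
      using \<open>r < R\<close> unfolding R_def less_cSup_iff[OF ne bdd] by blast
    then show ?thesis using mono[of r r'] by simp
  qed
  have above: "r \<le> R" if "f r \<le> t" for r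
    unfolding R_def using that bdd by (intro cSup_upper) auto
  show ?thesis
  proof (cases "f R \<le> t")
    case True
    then have "{x. f (dist y x) \<le> t} = cball y R"
      using above order_trans[OF mono True] by auto
    with True show ?thesis by (simp add: f_def)
  next
    case False
    then have eq: "{x. f (dist y x) \<le> t} = ball y R"
      using above below mono by (auto simp: order.strict_iff_order)
    \<comment> \<open>The open ball is exhausted by closed balls of radius below \<open>R\<close>,
      each of measure at most \<open>t\<close>.\<close>
    have "(\<lambda>n. f (R - 1 / real (Suc n))) \<longlonglongrightarrow> measure M (\<Union>n. cball y (R - 1 / real (Suc n)))"
      unfolding f_def
      by (intro finite_Lim_measure_incseq incseq_SucI subset_cball) (auto simp: field_simps)
    also have "(\<Union>n. cball y (R - 1 / real (Suc n))) = ball y R"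
    proof -
      have "\<exists>n. dist y x \<le> R - 1 / real (Suc n)" if "dist y x < R" for x
        using reals_Archimedean[of "R - dist y x"] that
        by (auto simp: inverse_eq_divide field_simps intro: less_imp_le)
      moreover have "dist y x < R" if "dist y x \<le> R - 1 / real (Suc n)" for x n
        using that by (rule le_less_trans) simp
      ultimately show ?thesis by auto
    qed
    finally have "measure M (ball y R) \<le> t"
      by (rule LIMSEQ_le_const2) (auto intro!: below)
    then show ?thesis using eq by (simp add: f_def)
  qed
qed

text \<open>By invariance the exceptional event at time \<open>n\<close> has measure at most
  \<open>n powr - c\<close>, which is summable for \<open>c > 1\<close>. At \<open>n = 0\<close>
  this bound is \<open>0\<close>, which \<open>measure_cball_dist_le\<close> still allows.\<close>

lemma AE_orbit_not_too_close:
  assumes T: "measure_preserving_map M T" and c: "c > 1"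
  shows "AE x in M. \<forall>\<^sub>F n in sequentially.
           real n powr - c < measure M (cball y (dist y ((T ^^ n) x)))"
proof -
  define F where "F x = measure M (cball y (dist y x))" for x
  define A where "A n = {x \<in> space M. F x \<le> real n powr - c}" for n
  have A: "A n \<in> sets M" for n
    unfolding A_def F_def using borel_measurable_measure_cball_dist[of y] by measurable
  define E where "E n = (T ^^ n) -` A n \<inter> space M" for n
  have E: "E n \<in> sets M" for n
    unfolding E_def using T A
    by (intro measurable_sets[OF measurable_funpow]) (auto simp: measure_preserving_map_def)
  have "measure M (E n) \<le> real n powr - c" for n
    unfolding E_def measure_preserving_map_funpow[OF T A]
    using measure_cball_dist_le[of "real n powr - c" y] by (simp add: A_def F_def space_UNIV)
  moreover have "summable (\<lambda>n. real n powr - c)"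
    using c by (simp add: summable_real_powr_iff)
  ultimately have "summable (\<lambda>n. measure M (E n))"
    by (auto intro: summable_comparison_test'[where N = 0])
  then have "AE x in M. \<forall>\<^sub>F n in sequentially. x \<in> space M - E n"
    using E by (intro borel_cantelli_AE1) (auto simp: emeasure_eq_measure)
  then show ?thesis
    by eventually_elim
      (auto simp: E_def A_def F_def space_UNIV not_le elim!: eventually_mono)
qed

text \<open>A countable union of preimages of a null point is null. This keeps the finitely many
  times not controlled by Borel-Cantelli at positive distance from \<open>y\<close>.\<close>

lemma AE_orbit_avoids_null_point:
  assumes T: "measure_preserving_map M T" and y: "measure M {y} = 0"
  shows "AE x in M. \<forall>n. (T ^^ n) x \<noteq> y"
  unfolding AE_all_countable
proof
  fix n
  have sy: "{y} \<in> sets M" by (simp add: sets_borel)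
  have "(T ^^ n) -` {y} \<inter> space M \<in> null_sets M"
  proof (rule null_setsI)
    show "emeasure M ((T ^^ n) -` {y} \<inter> space M) = 0"
      using measure_preserving_map_funpow[OF T sy, of n] y by (simp add: emeasure_eq_measure)
    show "(T ^^ n) -` {y} \<inter> space M \<in> sets M"
      using T sy by (intro measurable_sets[OF measurable_funpow])
        (auto simp: measure_preserving_map_def)
  qed
  then show "AE x in M. (T ^^ n) x \<noteq> y"
    by (rule AE_I') auto
qed

lemma inverse_le_lower_R:
  assumes supp: "y \<in> supp M" and y: "measure M {y} = 0" and c: "c > 0"
    and avoid: "\<And>n. (T ^^ n) x \<noteq> y"
    and far: "\<forall>\<^sub>F n in sequentially. real n powr - c < measure M (cball y (dist y ((T ^^ n) x)))"
  shows "ereal (1 / c) \<le> lower_R M T x y"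
proof -
  define f where "f r = measure M (cball y r)" for r
  define F where "F n = f (dist y ((T ^^ n) x))" for n
  have f_pos: "f r > 0" if "r > 0" for r
    using supp that by (simp add: supp_def f_def)
  obtain n0 where n0: "\<And>n. n \<ge> n0 \<Longrightarrow> real n powr - c < F n"
    using far by (auto simp: eventually_sequentially F_def f_def)
  have F_pos: "F n > 0" for n unfolding F_def using avoid[of n] by (intro f_pos) auto
  \<comment> \<open>A ball of measure below \<open>e\<close> cannot be hit before time
    \<open>n0\<close>; including \<open>1\<close> in the minimum keeps \<open>- ln (f r)\<close>
    positive.\<close>
  define e where "e = Min (insert 1 (F ` {..<n0}))"
  have e: "e > 0" "e \<le> 1" and eF: "\<And>n. n < n0 \<Longrightarrow> e \<le> F n"
    unfolding e_def using F_pos by auto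
  have "\<forall>\<^sub>F r in at_right 0. f r < e"
    unfolding f_def using order_tendstoD(2)[OF measure_cball_tendsto_0[OF y] e(1)] .
  with eventually_at_right_less[of "0::real"] have
    "\<forall>\<^sub>F r in at_right 0. ereal (1 / c) \<le>
       log_enat (waiting_time T (cball y r) x) / ereal (- ln (f r))"
  proof eventually_elim
    case (elim r)
    have fr: "f r > 0" using elim by (intro f_pos) simp
    define l where "l = - ln (f r)"
    have l: "l > 0" using fr elim e by (simp add: l_def)
    have "ereal (l / c) \<le> log_enat (waiting_time T (cball y r) x)"
    proof (rule le_log_enat_waiting_time)
      fix n assume n: "n \<ge> 1" "(T ^^ n) x \<in> cball y r"
      then have Fn: "F n \<le> f r"
        unfolding F_def f_def by (intro measure_cball_mono) simp
      then have "n \<ge> n0" using eF[of n] elim by (intro leI) auto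
      then have "real n powr - c < f r" using n0[of n] Fn by simp
      then have "ln (real n powr - c) < ln (f r)"
        using n fr by (subst ln_less_cancel_iff) auto
      then have "l < c * ln (real n)" using n by (simp add: ln_powr l_def)
      then show "l / c \<le> ln (real n)" using c by (simp add: field_simps)
    qed
    then have "ereal (l / c) / ereal l \<le> log_enat (waiting_time T (cball y r) x) / ereal l"
      using l by (intro ereal_divide_right_mono) auto
    then show ?case using l by (simp add: l_def)
  qed
  then show ?thesis
    unfolding lower_R_def f_def by (rule Liminf_bounded)
qed

text \<open>The exceptional null set depends on the exponent, so countably many exponents
  \<open>c k\<close> decreasing to \<open>1\<close> are used, and \<open>1 / c k\<close> tends to
  \<open>1\<close>.\<close>

lemma one_le_lower_R:
  assumes T: "measure_preserving_map M T" and supp: "y \<in> supp M" and y: "measure M {y} = 0"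
  shows "AE x in M. 1 \<le> lower_R M T x y"
proof -
  define c where "c k = 1 + 1 / real (Suc k)" for k
  have c: "c k > 1" for k by (simp add: c_def)
  have "AE x in M. \<forall>k. \<forall>\<^sub>F n in sequentially.
      real n powr - c k < measure M (cball y (dist y ((T ^^ n) x)))"
    unfolding AE_all_countable using AE_orbit_not_too_close[OF T c] by blast
  with AE_orbit_avoids_null_point[OF T y] show ?thesis
  proof eventually_elim
    case (elim x)
    have le: "ereal (1 / c k) \<le> lower_R M T x y" for k
      using elim c[of k] by (intro inverse_le_lower_R[OF supp y]) auto
    have "(\<lambda>k. 1 / c k) \<longlonglongrightarrow> 1 / (1 + 0)"
      unfolding c_def by (intro tendsto_intros LIMSEQ_Suc[OF lim_1_over_n]) auto
    then have "(\<lambda>k. ereal (1 / c k)) \<longlonglongrightarrow> 1"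
      by (simp add: one_ereal_def)
    then show ?case
      by (rule LIMSEQ_le_const2) (use le in auto)
  qed
qed

end

theorem theorem4p1:
  fixes M :: "'a::metric_space measure" and T :: "'a \<Rightarrow> 'a"
  assumes "prob_space M"
    and "sets M = sets borel"
    and "measure_preserving_map M T"
  shows "(\<forall>(s::real) y. s > 0 \<longrightarrow> y \<in> supp M \<longrightarrow> measure M {y} = 0 \<longrightarrow> MSTP_at M T s y \<longrightarrow>
            (AE x in M. lower_R M T x y \<le> ereal s)) \<and>
         (\<forall>s::real. s \<ge> 1 \<longrightarrow> nonatomic M \<longrightarrow> MSTP M T s \<longrightarrow>
            (\<forall>y\<in>supp M. AE x in M. 1 \<le> lower_R M T x y \<and> lower_R M T x y \<le> ereal s))"
proof -
  interpret metric_prob_space M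
    using assms by (simp add: metric_prob_space_def metric_prob_space_axioms_def)
  show ?thesis
  proof (intro conjI allI impI ballI)
    fix s :: real and y
    assume "s > 0" "y \<in> supp M" "measure M {y} = 0" "MSTP_at M T s y"
    then show "AE x in M. lower_R M T x y \<le> ereal s" by (rule lower_R_le)
  next
    fix s :: real and y
    assume s: "s \<ge> 1" and "nonatomic M" and "MSTP M T s" and y: "y \<in> supp M"
    then have "measure M {y} = 0" "MSTP_at M T s y"
      by (auto simp: nonatomic_def MSTP_def space_UNIV)
    with s y have "AE x in M. 1 \<le> lower_R M T x y" "AE x in M. lower_R M T x y \<le> ereal s"
      by (auto intro!: one_le_lower_R[OF assms(3)] lower_R_le)
    then show "AE x in M. 1 \<le> lower_R M T x y \<and> lower_R M T x y \<le> ereal s"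
      by (rule AE_conjI)
  qed
qed

end
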